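(* Consider the scheme $$\frac{1}{\Delta t}(U_i^{n+1}-U_i^n)+\frac1{\Delta x}\big(\underline\alpha_{i+1/2}F^{HLL}_{i+1/2}-\underline\alpha_{i-1/2}F^{HLL}_{i-1/2}\big)=\frac1{\Delta x}\big(\underline\alpha_{i+1/2}-\underline\alpha_{i-1/2}\big)F(U_i^n)-\frac{\gamma}{2}\big(\underline\alpha_{i+1/2}+\underline\alpha_{i-1/2}\big)R(U_i^n),$$ $i\in\mathbb{Z}$, with the notation of the context, under the CFL condition $b\,\Delta t/\Delta x\le 1/2$. (i) Assume that the matrix $\underline\sigma$ defines a spatially continuous map. Then the scheme is consistent with the equation $\partial_tU+\partial_xF(U)=-\gamma R(U)$. (ii) At time $t^n$, assume $U_i^n\in\Omega$ for all $i\in\mathbb{Z}$ and, in addition, that the state vectors $$U^{\star L}_{i+1/2}=\underline\alpha_{i+1/2}\tilde U^\star_{i+1/2}+(I-\underline\alpha_{i+1/2})\big(U_i^n-\bar R_{i+1/2}(U_i^n)\big),$$ $$U^{\star R}_{i+1/2}=\underline\alpha_{i+1/2}\tilde U^\star_{i+1/2}+(I-\underline\alpha_{i+1/2})\big(U_{i+1}^n-\bar R_{i+1/2}(U_{i+1}^n)\big)$$ belong to $\Omega$ for all $i\in\mathbb{Z}$. Then the updated state vector $U_i^{n+1}$ defined by the scheme belongs to $\Omega$ for all $i\in\mathbb{Z}$.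
   Context: $\Omega\subset\mathbb{R}^N$ is a convex open set, $F,R:\Omega\to\mathbb{R}^N$ are smooth, the system $\partial_tU+\partial_xF(U)=0$ is hyperbolic, and $\gamma>0$ is a fixed parameter. The uniform mesh has cells $[x_{i-1/2},x_{i+1/2})$, $x_{i+1/2}=x_i+\Delta x/2$, of constant size $\Delta x$; $t^{n+1}=t^n+\Delta t$; $b>0$ is a fixed constant (the numerical wave speed). $U_i^n$ is the constant approximate value on cell $i$ at time $t^n$. Define $$F^{HLL}_{i+1/2}=\tfrac12\big(F(U_i^n)+F(U_{i+1}^n)\big)-\tfrac b2\big(U_{i+1}^n-U_i^n\big),$$ $$\tilde U^\star_{i+1/2}=\tfrac12(U_i^n+U_{i+1}^n)-\tfrac1{2b}\big(F(U_{i+1}^n)-F(U_i^n)\big).$$ At each interface, $\underline\sigma_{i+1/2}$ is an $N\times N$ parameter matrix such that the inverses below exist, $I$ is the $N\times N$ identity, and $$\underline\alpha_{i+1/2}=\Big(I+\frac{\gamma\Delta x}{2b}(I+\underline\sigma_{i+1/2})\Big)^{-1},\qquad \bar R_{i+1/2}(U)=(I+\underline\sigma_{i+1/2})^{-1}R(U).$$ "$\underline\sigma$ defines a spatially continuous map" means $\underline\sigma_{i+1/2}=\underline\sigma(x_{i+1/2})$ for a continuous matrix-valued function $\underline\sigma$ of $x$. "Consistent" is meant in the usual sense: inserting a smooth function $U(t,x)$ with values in $\Omega$ into the scheme, the scheme's residual (left side minus right side) converges to $\partial_tU+\partial_xF(U)+\gamma R(U)$ as $\Delta t,\Delta x\to0$.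 *)

theory Defs
  imports "HOL-Analysis.Analysis"
begin

(* C^k through iterated directional derivatives.  It is meant for open S in finite dimension,
   where it agrees with the usual notion. *)
fun C_k_on :: "nat \<Rightarrow> 'a::euclidean_space set \<Rightarrow> ('a \<Rightarrow> 'b::euclidean_space) \<Rightarrow> bool" where
  "C_k_on 0 S f \<longleftrightarrow> continuous_on S f"
| "C_k_on (Suc k) S f \<longleftrightarrow>
     (\<forall>x\<in>S. f differentiable (at x)) \<and>
     (\<forall>v. C_k_on k S (\<lambda>x. frechet_derivative f (at x) v))"

definition smooth_on :: "'a::euclidean_space set \<Rightarrow> ('a \<Rightarrow> 'b::euclidean_space) \<Rightarrow> bool" where
  "smooth_on S f \<longleftrightarrow> (\<forall>k. C_k_on k S f)"

definition real_diagonalizable :: "real^'n^'n \<Rightarrow> bool" where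
  "real_diagonalizable A \<longleftrightarrow>
     (\<exists>P D :: real^'n^'n. invertible P \<and> (\<forall>i j. i \<noteq> j \<longrightarrow> D $ i $ j = 0) \<and> A ** P = P ** D)"

definition hyperbolic_on :: "(real^'n) set \<Rightarrow> (real^'n \<Rightarrow> real^'n) \<Rightarrow> bool" where
  "hyperbolic_on \<Omega> F \<longleftrightarrow> (\<forall>u\<in>\<Omega>. real_diagonalizable (jacobian F (at u)))"

(* Mesh functions are indexed by int.  For quantities living on interfaces, the index i stands
   for the interface i+1/2; the interface i-1/2 is therefore the index i-1. *)

definition F_HLL :: "(real^'n \<Rightarrow> real^'n) \<Rightarrow> real \<Rightarrow> (int \<Rightarrow> real^'n) \<Rightarrow> int \<Rightarrow> real^'n" where
  "F_HLL F b U i =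
     (1/2) *\<^sub>R (F (U i) + F (U (i+1))) - (b/2) *\<^sub>R (U (i+1) - U i)"

definition U_tilde :: "(real^'n \<Rightarrow> real^'n) \<Rightarrow> real \<Rightarrow> (int \<Rightarrow> real^'n) \<Rightarrow> int \<Rightarrow> real^'n" where
  "U_tilde F b U i =
     (1/2) *\<^sub>R (U i + U (i+1)) - (1/(2*b)) *\<^sub>R (F (U (i+1)) - F (U i))"

definition alpha_den :: "real \<Rightarrow> real \<Rightarrow> real \<Rightarrow> real^'n^'n \<Rightarrow> real^'n^'n" where
  "alpha_den \<gamma> b dx S = mat 1 + (\<gamma> * dx / (2*b)) *\<^sub>R (mat 1 + S)"

definition alpha :: "real \<Rightarrow> real \<Rightarrow> real \<Rightarrow> real^'n^'n \<Rightarrow> real^'n^'n" where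
  "alpha \<gamma> b dx S = matrix_inv (alpha_den \<gamma> b dx S)"

definition R_bar :: "(real^'n \<Rightarrow> real^'n) \<Rightarrow> real^'n^'n \<Rightarrow> real^'n \<Rightarrow> real^'n" where
  "R_bar R S u = matrix_inv (mat 1 + S) *v R u"

definition U_star_L ::
  "(real^'n \<Rightarrow> real^'n) \<Rightarrow> (real^'n \<Rightarrow> real^'n) \<Rightarrow> real \<Rightarrow> real \<Rightarrow> real \<Rightarrow>
   (int \<Rightarrow> real^'n^'n) \<Rightarrow> (int \<Rightarrow> real^'n) \<Rightarrow> int \<Rightarrow> real^'n" where
  "U_star_L F R \<gamma> b dx \<sigma> U i =
     alpha \<gamma> b dx (\<sigma> i) *v U_tilde F b U i
     + (mat 1 - alpha \<gamma> b dx (\<sigma> i)) *v (U i - R_bar R (\<sigma> i) (U i))"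

definition U_star_R ::
  "(real^'n \<Rightarrow> real^'n) \<Rightarrow> (real^'n \<Rightarrow> real^'n) \<Rightarrow> real \<Rightarrow> real \<Rightarrow> real \<Rightarrow>
   (int \<Rightarrow> real^'n^'n) \<Rightarrow> (int \<Rightarrow> real^'n) \<Rightarrow> int \<Rightarrow> real^'n" where
  "U_star_R F R \<gamma> b dx \<sigma> U i =
     alpha \<gamma> b dx (\<sigma> i) *v U_tilde F b U i
     + (mat 1 - alpha \<gamma> b dx (\<sigma> i)) *v (U (i+1) - R_bar R (\<sigma> i) (U (i+1)))"

definition scheme_lhs ::
  "(real^'n \<Rightarrow> real^'n) \<Rightarrow> real \<Rightarrow> real \<Rightarrow> real \<Rightarrow> real \<Rightarrow>
   (int \<Rightarrow> real^'n^'n) \<Rightarrow> (int \<Rightarrow> real^'n) \<Rightarrow> (int \<Rightarrow> real^'n) \<Rightarrow> int \<Rightarrow> real^'n" where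
  "scheme_lhs F \<gamma> b dt dx \<sigma> U Unew i =
     (1/dt) *\<^sub>R (Unew i - U i)
     + (1/dx) *\<^sub>R (alpha \<gamma> b dx (\<sigma> i) *v F_HLL F b U i
                  - alpha \<gamma> b dx (\<sigma> (i-1)) *v F_HLL F b U (i-1))"

definition scheme_rhs ::
  "(real^'n \<Rightarrow> real^'n) \<Rightarrow> (real^'n \<Rightarrow> real^'n) \<Rightarrow> real \<Rightarrow> real \<Rightarrow> real \<Rightarrow>
   (int \<Rightarrow> real^'n^'n) \<Rightarrow> (int \<Rightarrow> real^'n) \<Rightarrow> int \<Rightarrow> real^'n" where
  "scheme_rhs F R \<gamma> b dx \<sigma> U i =
     (1/dx) *\<^sub>R ((alpha \<gamma> b dx (\<sigma> i) - alpha \<gamma> b dx (\<sigma> (i-1))) *v F (U i))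
     - (\<gamma>/2) *\<^sub>R ((alpha \<gamma> b dx (\<sigma> i) + alpha \<gamma> b dx (\<sigma> (i-1))) *v R (U i))"

(* The residual at the mesh node (t, x) of the function U on the mesh x_i = x + i dx, so that the
   node is the cell centre of index 0.  Here \<sigma> is a function of the space variable, sampled at
   the interfaces x_i + dx/2. *)
definition scheme_residual ::
  "(real^'n \<Rightarrow> real^'n) \<Rightarrow> (real^'n \<Rightarrow> real^'n) \<Rightarrow> real \<Rightarrow> real \<Rightarrow>
   (real \<Rightarrow> real^'n^'n) \<Rightarrow> (real \<times> real \<Rightarrow> real^'n) \<Rightarrow>
   real \<Rightarrow> real \<Rightarrow> real \<Rightarrow> real \<Rightarrow> real^'n" where
  "scheme_residual F R \<gamma> b \<sigma> U t x dt dx =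
     (let xc = (\<lambda>i::int. x + of_int i * dx);
          \<sigma>h = (\<lambda>i. \<sigma> (xc i + dx/2));
          Uold = (\<lambda>i. U (t, xc i));
          Unew = (\<lambda>i. U (t + dt, xc i))
      in scheme_lhs F \<gamma> b dt dx \<sigma>h Uold Unew 0 - scheme_rhs F R \<gamma> b dx \<sigma>h Uold 0)"

(* The test functions U are smooth on an arbitrary open set W of space-time, which covers both
   global functions and functions on a time interval.  For small steps the residual only involves
   values of U in W.  The limit is taken along positive steps subject to the CFL condition. *)
definition scheme_consistent ::
  "(real^'n) set \<Rightarrow> (real^'n \<Rightarrow> real^'n) \<Rightarrow> (real^'n \<Rightarrow> real^'n) \<Rightarrow> real \<Rightarrow> real \<Rightarrow>
   (real \<Rightarrow> real^'n^'n) \<Rightarrow> bool" where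
  "scheme_consistent \<Omega> F R \<gamma> b \<sigma> \<longleftrightarrow>
     (\<forall>W U. open W \<and> smooth_on W U \<and> U ` W \<subseteq> \<Omega> \<longrightarrow>
       (\<forall>t x. (t, x) \<in> W \<longrightarrow>
         ((\<lambda>(dt, dx). scheme_residual F R \<gamma> b \<sigma> U t x dt dx) \<longlongrightarrow>
            vector_derivative (\<lambda>s. U (s, x)) (at t)
            + vector_derivative (\<lambda>y. F (U (t, y))) (at x)
            + \<gamma> *\<^sub>R R (U (t, x)))
         (at (0, 0) within {(dt, dx). 0 < dt \<and> 0 < dx \<and> b * dt / dx \<le> 1/2})))"

end

theory Submission
  imports Defs
begin

text \<open>
  Everything follows from one rearrangement of the scheme. The term
  \<open>(\<alpha>\<^sub>+ - \<alpha>\<^sub>-) F(U\<^sub>i)\<close>, with \<open>+\<close> and \<open>-\<close> for the interfaces \<open>i + 1/2\<close> and \<open>i - 1/2\<close>, can be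
  moved to the left and absorbed into the fluxes, so that each matrix \<open>\<alpha>\<close> multiplies only a flux \<^emph>\<open>difference\<close>
  \<open>F\<^sup>H\<^sup>L\<^sup>L - F(U\<^sub>i)\<close> and a source \<open>R(U\<^sub>i)\<close>: see lemma \<open>scheme_difference\<close>.

  Consistency. Divided by the mesh size, a flux difference tends to \<open>F\<^sub>x/2 - b U\<^sub>x/2\<close> on the
  right of the cell and to \<open>- F\<^sub>x/2 - b U\<^sub>x/2\<close> on its left. Both interface matrices tend to the
  identity: continuity of \<open>\<sigma>\<close> keeps it bounded near the node, so the matrix inverted in \<open>\<alpha>\<close>
  tends to \<open>I\<close>. Hence in the limit the numerical viscosity cancels between the two interfaces,
  the fluxes give \<open>F\<^sub>x\<close>, and the two sources add up to \<open>\<gamma> R\<close>. No quotient such as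
  \<open>(\<alpha>\<^sub>+ - \<alpha>\<^sub>-)/\<Delta>x\<close> ever occurs, which is why mere continuity of \<open>\<sigma>\<close> suffices.

  Robustness. The flux differences are \<open>-b\<close> (right interface) and \<open>b\<close> (left interface) times the
  deviations \<open>U_tilde - U\<^sub>i\<close>, and \<open>(I - \<alpha>)(I + \<sigma>)\<^sup>-\<^sup>1\<close> is the multiple \<open>\<gamma> \<Delta>x / (2b)\<close> of \<open>\<alpha>\<close>.
  Thus \<open>U\<^sup>*\<^sup>L\<close> at \<open>i + 1/2\<close> and \<open>U\<^sup>*\<^sup>R\<close> at \<open>i - 1/2\<close> are \<open>U\<^sub>i\<close> plus exactly the increments that
  these interfaces produce in the scheme, up to the factor \<open>\<lambda> = b \<Delta>t / \<Delta>x\<close>, and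
  \<open>U\<^sub>i\<^sup>n\<^sup>+\<^sup>1 = (1 - 2 \<lambda>) U\<^sub>i + \<lambda> U\<^sup>*\<^sup>L + \<lambda> U\<^sup>*\<^sup>R\<close> is a convex combination as soon as
  \<open>\<lambda> \<le> 1/2\<close> (lemma \<open>scheme_update_convex_combination\<close>).
\<close>

section \<open>Limits of matrix inverses and of difference quotients\<close>

lemma matrix_inv_inverse:
  assumes "invertible A"
  shows "A ** matrix_inv A = mat 1" and "matrix_inv A ** A = mat 1"
  using someI_ex[OF assms[unfolded invertible_def]] by (simp_all add: matrix_inv_def)

lemma tendsto_det [tendsto_intros]:
  fixes A :: "'s \<Rightarrow> real^'n^'n"
  assumes "(A \<longlongrightarrow> L) G"
  shows "((\<lambda>s. det (A s)) \<longlongrightarrow> det L) G"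
  unfolding det_def by (intro tendsto_intros assms)

text \<open>By Cramer's rule, the solution of a linear system is a rational function of the matrix and
  the right-hand side whose only denominator is the determinant, hence continuous in both wherever
  the matrix is invertible.\<close>

lemma tendsto_matrix_inv_vector:
  fixes A :: "'s \<Rightarrow> real^'n^'n"
  assumes A: "(A \<longlongrightarrow> L) G" and L: "invertible L" and w: "(w \<longlongrightarrow> v) G"
  shows "((\<lambda>s. matrix_inv (A s) *v w s) \<longlongrightarrow> matrix_inv L *v v) G"
proof -
  have solve: "matrix_inv B *v z = (\<chi> k. det (\<chi> i j. if j = k then z $ i else B $ i $ j) / det B)"
    if "det B \<noteq> 0" for B :: "real^'n^'n" and z
  proof -
    have "B ** matrix_inv B = mat 1"
      using that by (simp add: invertible_det_nz[symmetric] matrix_inv_inverse)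
    then have "B *v (matrix_inv B *v z) = z"
      by (simp add: matrix_vector_mul_assoc)
    then show ?thesis
      using cramer[OF that] by blast
  qed
  have detL: "det L \<noteq> 0"
    using L by (simp add: invertible_det_nz)
  have ev: "\<forall>\<^sub>F s in G. det (A s) \<noteq> 0"
    by (rule tendsto_imp_eventually_ne[OF tendsto_det[OF A] detL])
  have entry: "((\<lambda>s. if j = k then w s $ i else A s $ i $ j) \<longlongrightarrow>
      (if j = k then v $ i else L $ i $ j)) G" for i j k
    by (cases "j = k") (auto intro!: tendsto_intros A w)
  have "((\<lambda>s. \<chi> k. det (\<chi> i j. if j = k then w s $ i else A s $ i $ j) / det (A s)) \<longlongrightarrow>
      (\<chi> k. det (\<chi> i j. if j = k then v $ i else L $ i $ j) / det L)) G"
    by (intro tendsto_intros entry A detL)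
  then show ?thesis
    unfolding solve[OF detL]
    by (rule Lim_transform_eventually) (use ev in \<open>auto elim!: eventually_mono simp: solve\<close>)
qed

lemma has_vector_derivative_quotient_tendsto:
  fixes f :: "real \<Rightarrow> 'a::real_normed_vector"
  assumes f: "(f has_vector_derivative f') (at x)" and h: "filterlim h (at 0) G"
  shows "((\<lambda>s. (1 / h s) *\<^sub>R (f (x + h s) - f x)) \<longlongrightarrow> f') G"
proof -
  have "((\<lambda>r. norm (f (x + r) - f x - r *\<^sub>R f') / norm r) \<longlongrightarrow> 0) (at 0)"
    using f by (simp add: has_vector_derivative_def has_derivative_at)
  then have "((\<lambda>r. norm ((1 / r) *\<^sub>R (f (x + r) - f x) - f')) \<longlongrightarrow> 0) (at 0)"
  proof (rule Lim_transform_eventually)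
    have "norm (f (x + r) - f x - r *\<^sub>R f') / norm r
        = norm ((1 / r) *\<^sub>R (f (x + r) - f x) - f')" if "r \<noteq> 0" for r
    proof -
      have "(1 / r) *\<^sub>R (f (x + r) - f x) - f' = (1 / r) *\<^sub>R (f (x + r) - f x - r *\<^sub>R f')"
        using that by (simp add: scaleR_diff_right)
      then show ?thesis by simp
    qed
    then show "\<forall>\<^sub>F r in at 0. norm (f (x + r) - f x - r *\<^sub>R f') / norm r
        = norm ((1 / r) *\<^sub>R (f (x + r) - f x) - f')"
      by (auto simp: eventually_at_filter)
  qed
  then have "((\<lambda>r. (1 / r) *\<^sub>R (f (x + r) - f x)) \<longlongrightarrow> f') (at 0)"
    by (simp add: tendsto_norm_zero_iff Lim_null[symmetric])
  from filterlim_compose[OF this h] show ?thesis .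
qed

section \<open>The damping matrix\<close>

text \<open>The matrix to be inverted tends to the identity, because the factor \<open>d\<close> vanishes in the limit
  while \<open>S\<close> converges. In particular it is invertible on fine meshes, so the default values of
  \<open>matrix_inv\<close> on coarse ones do not affect the limit.\<close>

lemma tendsto_alpha_vector:
  fixes S :: "'s \<Rightarrow> real^'n^'n"
  assumes d: "(d \<longlongrightarrow> 0) G" and S: "(S \<longlongrightarrow> S0) G" and w: "(w \<longlongrightarrow> v) G"
  shows "((\<lambda>s. alpha \<gamma> b (d s) (S s) *v w s) \<longlongrightarrow> v) G"
proof -
  have "((\<lambda>s. mat 1 + (\<gamma> / (2 * b) * d s) *\<^sub>R (mat 1 + S s)) \<longlongrightarrow>
      mat 1 + (\<gamma> / (2 * b) * 0) *\<^sub>R (mat 1 + S0)) G"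
    by (intro tendsto_add tendsto_scaleR tendsto_mult tendsto_const d S)
  then have den: "((\<lambda>s. alpha_den \<gamma> b (d s) (S s)) \<longlongrightarrow> mat 1) G"
    by (simp add: alpha_den_def)
  have inv1: "invertible (mat 1 :: real^'n^'n)"
    by (simp add: invertible_det_nz)
  have "matrix_inv (mat 1 :: real^'n^'n) = mat 1"
    using matrix_inv_inverse[OF inv1] by simp
  then show ?thesis
    using tendsto_matrix_inv_vector[OF den inv1 w] by (simp add: alpha_def)
qed

text \<open>Since \<open>\<alpha>\<^sup>-\<^sup>1 = I + c (I + \<sigma>)\<close> with \<open>c = \<gamma> \<Delta>x / (2b)\<close>, one has
  \<open>I - \<alpha> = \<alpha> (\<alpha>\<^sup>-\<^sup>1 - I) = c \<alpha> (I + \<sigma>)\<close>, and the factor \<open>I + \<sigma>\<close> cancels the inverse that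
  \<open>R_bar\<close> contains.\<close>

lemma one_minus_alpha_R_bar:
  fixes S :: "real^'n^'n"
  assumes S: "invertible (mat 1 + S)" and den: "invertible (alpha_den \<gamma> b dx S)"
  shows "(mat 1 - alpha \<gamma> b dx S) *v R_bar R S u
       = (\<gamma> * dx / (2*b)) *\<^sub>R (alpha \<gamma> b dx S *v R u)"
proof -
  define r where "r = R_bar R S u"
  have "(mat 1 + S) ** matrix_inv (mat 1 + S) = mat 1"
    using matrix_inv_inverse[OF S] by simp
  then have r: "(mat 1 + S) *v r = R u"
    by (simp add: r_def R_bar_def matrix_vector_mul_assoc)
  have "alpha \<gamma> b dx S ** alpha_den \<gamma> b dx S = mat 1"
    using matrix_inv_inverse[OF den] by (simp add: alpha_def)
  then have "r = alpha \<gamma> b dx S *v (alpha_den \<gamma> b dx S *v r)"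
    by (simp add: matrix_vector_mul_assoc)
  also have "alpha_den \<gamma> b dx S *v r = mat 1 *v r + (\<gamma> * dx / (2*b)) *\<^sub>R ((mat 1 + S) *v r)"
    by (simp only: alpha_den_def matrix_vector_mult_add_rdistrib scaleR_matrix_vector_assoc[symmetric])
  also have "\<dots> = r + (\<gamma> * dx / (2*b)) *\<^sub>R R u"
    by (simp only: r matrix_vector_mul_lid)
  finally have "r = alpha \<gamma> b dx S *v r + (\<gamma> * dx / (2*b)) *\<^sub>R (alpha \<gamma> b dx S *v R u)"
    by (simp only: matrix_vector_right_distrib matrix_vector_mult_scaleR)
  then have "r - alpha \<gamma> b dx S *v r = (\<gamma> * dx / (2*b)) *\<^sub>R (alpha \<gamma> b dx S *v R u)"
    by (simp only: diff_eq_eq add.commute)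
  then show ?thesis
    by (simp add: r_def matrix_vector_mult_diff_rdistrib)
qed

section \<open>Well-balanced form of the scheme\<close>

text \<open>The next two identities are the Rankine-Hugoniot relations of the HLL solver across its two
  waves, of speeds \<open>-b\<close> and \<open>b\<close>, which surround the intermediate state \<open>U_tilde\<close>.\<close>

lemma F_HLL_minus_left:
  assumes "b \<noteq> 0"
  shows "F_HLL F b U i - F (U i) = - (b *\<^sub>R (U_tilde F b U i - U i))"
  using assms by (simp add: F_HLL_def U_tilde_def vec_eq_iff field_simps)

lemma F_HLL_minus_right:
  assumes "b \<noteq> 0"
  shows "F_HLL F b U i - F (U (i+1)) = b *\<^sub>R (U_tilde F b U i - U (i+1))"
  using assms by (simp add: F_HLL_def U_tilde_def vec_eq_iff field_simps)

text \<open>The term \<open>(\<alpha>\<^sub>+ - \<alpha>\<^sub>-) F(U\<^sub>i)\<close> on the right of the scheme is what recentres both fluxes at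
  the physical flux \<open>F(U\<^sub>i)\<close> of the cell. Both parts of the theorem start from this form.\<close>

lemma scheme_difference:
  "scheme_lhs F \<gamma> b dt dx \<sigma> U Unew i - scheme_rhs F R \<gamma> b dx \<sigma> U i =
     (1/dt) *\<^sub>R (Unew i - U i)
     + alpha \<gamma> b dx (\<sigma> i) *v ((1/dx) *\<^sub>R (F_HLL F b U i - F (U i)))
     - alpha \<gamma> b dx (\<sigma> (i-1)) *v ((1/dx) *\<^sub>R (F_HLL F b U (i-1) - F (U i)))
     + (\<gamma>/2) *\<^sub>R (alpha \<gamma> b dx (\<sigma> i) *v R (U i) + alpha \<gamma> b dx (\<sigma> (i-1)) *v R (U i))"
  by (simp add: scheme_lhs_def scheme_rhs_def matrix_vector_mult_scaleR
      matrix_vector_mult_diff_distrib matrix_vector_mult_diff_rdistrib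
      matrix_vector_mult_add_rdistrib scaleR_diff_right scaleR_add_right)

text \<open>Without \<open>I - \<alpha>\<close>, the intermediate states are the cell value plus the image under \<open>\<alpha>\<close> of a
  deviation and of a source, the same vectors to which the scheme applies \<open>\<alpha>\<close>.\<close>

lemma U_star_L_eq:
  assumes "invertible (mat 1 + \<sigma> i)" and "invertible (alpha_den \<gamma> b dx (\<sigma> i))"
  shows "U_star_L F R \<gamma> b dx \<sigma> U i =
    U i + alpha \<gamma> b dx (\<sigma> i) *v (U_tilde F b U i - U i)
    - (\<gamma> * dx / (2*b)) *\<^sub>R (alpha \<gamma> b dx (\<sigma> i) *v R (U i))"
  unfolding U_star_L_def matrix_vector_mult_diff_distrib one_minus_alpha_R_bar[OF assms]
  by (simp add: matrix_vector_mult_diff_rdistrib)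

lemma U_star_R_eq:
  assumes "invertible (mat 1 + \<sigma> i)" and "invertible (alpha_den \<gamma> b dx (\<sigma> i))"
  shows "U_star_R F R \<gamma> b dx \<sigma> U i =
    U (i+1) + alpha \<gamma> b dx (\<sigma> i) *v (U_tilde F b U i - U (i+1))
    - (\<gamma> * dx / (2*b)) *\<^sub>R (alpha \<gamma> b dx (\<sigma> i) *v R (U (i+1)))"
  unfolding U_star_R_def matrix_vector_mult_diff_distrib one_minus_alpha_R_bar[OF assms]
  by (simp add: matrix_vector_mult_diff_rdistrib)

section \<open>Robustness\<close>

text \<open>Cell \<open>i\<close> receives the left state of its right interface and the right state of its left
  interface. Both deviate from the same value \<open>U i\<close>, and adding \<open>b dt/dx\<close> times each deviation
  to \<open>U i\<close> is the scheme.\<close>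

lemma scheme_update_convex_combination:
  assumes b: "b > 0" and dt: "dt > 0" and dx: "dx > 0"
    and inv: "\<And>i. invertible (mat 1 + \<sigma> i)" "\<And>i. invertible (alpha_den \<gamma> b dx (\<sigma> i))"
    and scheme: "scheme_lhs F \<gamma> b dt dx \<sigma> U Unew i = scheme_rhs F R \<gamma> b dx \<sigma> U i"
  shows "Unew i = (1 - 2 * (b * dt / dx)) *\<^sub>R U i + (b * dt / dx) *\<^sub>R U_star_L F R \<gamma> b dx \<sigma> U i
    + (b * dt / dx) *\<^sub>R U_star_R F R \<gamma> b dx \<sigma> U (i-1)"
proof -
  define p where "p = alpha \<gamma> b dx (\<sigma> i) *v (U_tilde F b U i - U i)"
  define q where "q = alpha \<gamma> b dx (\<sigma> (i-1)) *v (U_tilde F b U (i-1) - U i)"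
  define r where "r = alpha \<gamma> b dx (\<sigma> i) *v R (U i)"
  define s where "s = alpha \<gamma> b dx (\<sigma> (i-1)) *v R (U i)"
  have L: "U_star_L F R \<gamma> b dx \<sigma> U i = U i + p - (\<gamma> * dx / (2*b)) *\<^sub>R r"
    unfolding U_star_L_eq[OF inv] p_def r_def ..
  have R: "U_star_R F R \<gamma> b dx \<sigma> U (i-1) = U i + q - (\<gamma> * dx / (2*b)) *\<^sub>R s"
    unfolding U_star_R_eq[OF inv] q_def s_def by simp
  have left: "F_HLL F b U i - F (U i) = - (b *\<^sub>R (U_tilde F b U i - U i))"
    using b by (simp add: F_HLL_minus_left)
  have right: "F_HLL F b U (i-1) - F (U i) = b *\<^sub>R (U_tilde F b U (i-1) - U i)"
    using F_HLL_minus_right[of b F U "i-1"] b by simp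
  have neg: "A *v (- z) = - (A *v z)" for A :: "real^'a^'a" and z
    using matrix_vector_mult_diff_distrib[of A 0 z] by simp
  have "(1/dt) *\<^sub>R (Unew i - U i) - (b/dx) *\<^sub>R p - (b/dx) *\<^sub>R q + (\<gamma>/2) *\<^sub>R (r + s) = 0"
    using scheme_difference[of F \<gamma> b dt dx \<sigma> U Unew i R] scheme
    unfolding left right p_def q_def r_def s_def
    by (simp add: neg matrix_vector_mult_scaleR)
  \<comment> \<open>Multiplication by \<open>dt\<close> turns the flux factor \<open>b/dx\<close> into \<open>\<lambda> = b dt/dx\<close>; the source factor
    is \<open>dt \<gamma>/2 = \<lambda> (\<gamma> dx/(2b))\<close>, as in the intermediate states.\<close>
  then have "dt *\<^sub>R ((1/dt) *\<^sub>R (Unew i - U i) - (b/dx) *\<^sub>R p - (b/dx) *\<^sub>R q + (\<gamma>/2) *\<^sub>R (r + s)) = 0"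
    by simp
  then have "Unew i - U i - (b*dt/dx) *\<^sub>R p - (b*dt/dx) *\<^sub>R q + (dt*\<gamma>/2) *\<^sub>R (r + s) = 0"
    using dt by (simp add: algebra_simps)
  then show ?thesis
    unfolding L R using b dx by (simp add: vec_eq_iff field_simps)
qed

lemma convex_three_points:
  assumes "convex C" "x \<in> C" "y \<in> C" "z \<in> C" "0 \<le> l" "l \<le> 1/2"
  shows "(1 - 2 * l) *\<^sub>R x + l *\<^sub>R y + l *\<^sub>R z \<in> C"
proof -
  have "(1/2) *\<^sub>R y + (1/2) *\<^sub>R z \<in> C"
    using assms by (intro convexD) auto
  then have "(1 - 2 * l) *\<^sub>R x + (2 * l) *\<^sub>R ((1/2) *\<^sub>R y + (1/2) *\<^sub>R z) \<in> C"
    using assms by (intro convexD) auto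
  then show ?thesis by (simp add: scaleR_add_right add.assoc)
qed

section \<open>Consistency\<close>

lemma smooth_on_imp_differentiable: "smooth_on S f \<Longrightarrow> x \<in> S \<Longrightarrow> f differentiable (at x)"
  unfolding smooth_on_def by (drule spec[of _ "Suc 0"]) simp

text \<open>The centred part of the HLL flux contributes half a one-sided difference quotient of \<open>F \<circ> u\<close>,
  and its viscosity \<open>-b/2\<close> times that of \<open>u\<close>. From the right interface to the left
  one the flux part changes sign while the viscous part does not; this is what makes the viscosity
  disappear from the difference of the two limits.\<close>

lemma F_HLL_quotient_left_tendsto:
  fixes u :: "real \<Rightarrow> real^'n"
  assumes u: "(u has_vector_derivative u') (at x)"
    and Fu: "((\<lambda>y. F (u y)) has_vector_derivative f') (at x)"
    and h: "filterlim h (at 0) G"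
  shows "((\<lambda>s. (1 / h s) *\<^sub>R (F_HLL F b (\<lambda>i. u (x + of_int i * h s)) 0 - F (u x)))
     \<longlongrightarrow> (1/2) *\<^sub>R f' - (b/2) *\<^sub>R u') G"
proof -
  have "((\<lambda>s. (1/2) *\<^sub>R ((1 / h s) *\<^sub>R (F (u (x + h s)) - F (u x)))
      - (b/2) *\<^sub>R ((1 / h s) *\<^sub>R (u (x + h s) - u x)))
      \<longlongrightarrow> (1/2) *\<^sub>R f' - (b/2) *\<^sub>R u') G"
    by (intro tendsto_diff tendsto_scaleR tendsto_const
        has_vector_derivative_quotient_tendsto[OF u h]
        has_vector_derivative_quotient_tendsto[OF Fu h])
  moreover have "(1/2) *\<^sub>R ((1 / h s) *\<^sub>R (F (u (x + h s)) - F (u x)))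
      - (b/2) *\<^sub>R ((1 / h s) *\<^sub>R (u (x + h s) - u x))
    = (1 / h s) *\<^sub>R (F_HLL F b (\<lambda>i. u (x + of_int i * h s)) 0 - F (u x))" for s
    by (cases "h s = 0") (simp_all add: F_HLL_def vec_eq_iff field_simps)
  ultimately show ?thesis
    by (simp only:)
qed

lemma F_HLL_quotient_right_tendsto:
  fixes u :: "real \<Rightarrow> real^'n"
  assumes u: "(u has_vector_derivative u') (at x)"
    and Fu: "((\<lambda>y. F (u y)) has_vector_derivative f') (at x)"
    and h: "filterlim h (at 0) G"
  shows "((\<lambda>s. (1 / h s) *\<^sub>R (F_HLL F b (\<lambda>i. u (x + of_int i * h s)) (- 1) - F (u x)))
     \<longlongrightarrow> - ((1/2) *\<^sub>R f') - (b/2) *\<^sub>R u') G"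
proof -
  have neg: "filterlim (\<lambda>s. - h s) (at 0) G"
    using h tendsto_minus[of h 0 G] by (simp add: filterlim_at)
  have "((\<lambda>s. - ((1/2) *\<^sub>R ((1 / - h s) *\<^sub>R (F (u (x + - h s)) - F (u x))))
      - (b/2) *\<^sub>R ((1 / - h s) *\<^sub>R (u (x + - h s) - u x)))
      \<longlongrightarrow> - ((1/2) *\<^sub>R f') - (b/2) *\<^sub>R u') G"
    by (intro tendsto_diff tendsto_minus tendsto_scaleR tendsto_const
        has_vector_derivative_quotient_tendsto[OF u neg]
        has_vector_derivative_quotient_tendsto[OF Fu neg])
  moreover have "- ((1/2) *\<^sub>R ((1 / - h s) *\<^sub>R (F (u (x + - h s)) - F (u x))))
      - (b/2) *\<^sub>R ((1 / - h s) *\<^sub>R (u (x + - h s) - u x))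
    = (1 / h s) *\<^sub>R (F_HLL F b (\<lambda>i. u (x + of_int i * h s)) (- 1) - F (u x))" for s
    by (cases "h s = 0") (simp_all add: F_HLL_def vec_eq_iff field_simps)
  ultimately show ?thesis
    by (simp only:)
qed

text \<open>Pointwise consistency needs only derivatives at the node itself, and the two steps may tend
  to zero independently of each other, because the time and space quotients never mix.\<close>

lemma scheme_residual_tendsto:
  fixes U :: "real \<times> real \<Rightarrow> real^'n"
  assumes cont: "isCont \<sigma> x"
    and Ut: "((\<lambda>s. U (s, x)) has_vector_derivative ut) (at t)"
    and Ux: "((\<lambda>y. U (t, y)) has_vector_derivative ux) (at x)"
    and Fx: "((\<lambda>y. F (U (t, y))) has_vector_derivative fx) (at x)"
    and k: "filterlim k (at 0) G" and h: "filterlim h (at 0) G"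
  shows "((\<lambda>s. scheme_residual F R \<gamma> b \<sigma> U t x (k s) (h s))
     \<longlongrightarrow> ut + fx + \<gamma> *\<^sub>R R (U (t, x))) G"
proof -
  have hz: "(h \<longlongrightarrow> 0) G"
    using h by (simp add: filterlim_at)
  have p: "((\<lambda>s. \<sigma> (x + h s / 2)) \<longlongrightarrow> \<sigma> x) G"
    by (rule isCont_tendsto_compose[OF cont])
      (use tendsto_add[OF tendsto_const tendsto_divide[OF hz tendsto_const], of 2 x] in simp)
  have m: "((\<lambda>s. \<sigma> (x + - h s + h s / 2)) \<longlongrightarrow> \<sigma> x) G"
    by (rule isCont_tendsto_compose[OF cont])
      (use tendsto_add[OF tendsto_add[OF tendsto_const tendsto_minus[OF hz]] tendsto_divide[OF hz tendsto_const], of 2 x] in simp)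
  have "((\<lambda>s. (1 / k s) *\<^sub>R (U (t + k s, x) - U (t, x))
      + alpha \<gamma> b (h s) (\<sigma> (x + h s / 2)) *v
          ((1 / h s) *\<^sub>R (F_HLL F b (\<lambda>i. U (t, x + of_int i * h s)) 0 - F (U (t, x))))
      - alpha \<gamma> b (h s) (\<sigma> (x + - h s + h s / 2)) *v
          ((1 / h s) *\<^sub>R (F_HLL F b (\<lambda>i. U (t, x + of_int i * h s)) (- 1) - F (U (t, x))))
      + (\<gamma>/2) *\<^sub>R (alpha \<gamma> b (h s) (\<sigma> (x + h s / 2)) *v R (U (t, x))
          + alpha \<gamma> b (h s) (\<sigma> (x + - h s + h s / 2)) *v R (U (t, x))))
     \<longlongrightarrow> ut + ((1/2) *\<^sub>R fx - (b/2) *\<^sub>R ux) - (- ((1/2) *\<^sub>R fx) - (b/2) *\<^sub>R ux)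
        + (\<gamma>/2) *\<^sub>R (R (U (t, x)) + R (U (t, x)))) G"
    by (intro tendsto_add tendsto_diff tendsto_scaleR tendsto_const
        has_vector_derivative_quotient_tendsto[OF Ut k]
        tendsto_alpha_vector[OF hz p] tendsto_alpha_vector[OF hz m]
        F_HLL_quotient_left_tendsto[OF Ux Fx h] F_HLL_quotient_right_tendsto[OF Ux Fx h])
  moreover have "ut + ((1/2) *\<^sub>R fx - (b/2) *\<^sub>R ux) - (- ((1/2) *\<^sub>R fx) - (b/2) *\<^sub>R ux)
        + (\<gamma>/2) *\<^sub>R (r + r) = ut + fx + \<gamma> *\<^sub>R r" for r :: "real^'n"
    by (simp add: vec_eq_iff)
  ultimately show ?thesis
    by (simp only: scheme_residual_def Let_def scheme_difference of_int_0 mult_zero_left add_0_right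
        diff_0 of_int_minus of_int_1 mult_minus_left mult_1)
qed

lemma scheme_is_consistent:
  fixes \<sigma> :: "real \<Rightarrow> real^'n^'n"
  assumes F: "smooth_on \<Omega> F" and cont: "continuous_on UNIV \<sigma>"
  shows "scheme_consistent \<Omega> F R \<gamma> b \<sigma>"
  unfolding scheme_consistent_def
proof (intro allI impI, elim conjE)
  fix W :: "(real \<times> real) set" and U :: "real \<times> real \<Rightarrow> real^'n" and t x
  assume "smooth_on W U" and UW: "U ` W \<subseteq> \<Omega>" and tx: "(t, x) \<in> W"
  then have dU: "U differentiable (at (t, x))"
    by (simp add: smooth_on_imp_differentiable)
  have dF: "F differentiable (at (U (t, x)))"
    using UW tx F by (intro smooth_on_imp_differentiable) auto
  have Ut: "(\<lambda>s. U (s, x)) differentiable (at t)"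
    using differentiable_chain_at[of "\<lambda>s. (s, x)" t U] dU
    by (simp add: o_def differentiable_Pair)
  have Ux: "(\<lambda>y. U (t, y)) differentiable (at x)"
    using differentiable_chain_at[of "\<lambda>y. (t, y)" x U] dU
    by (simp add: o_def differentiable_Pair)
  have Fx: "(\<lambda>y. F (U (t, y))) differentiable (at x)"
    using differentiable_chain_at[OF Ux dF] by (simp add: o_def)
  define T where "T = {(dt, dx). 0 < dt \<and> 0 < dx \<and> b * dt / dx \<le> (1::real)/2}"
  have nonzero: "\<forall>\<^sub>F s in at (0, 0) within T. fst s \<noteq> 0 \<and> snd s \<noteq> 0"
    unfolding eventually_at_filter by (intro always_eventually) (auto simp: T_def)
  have "((\<lambda>s::real\<times>real. s) \<longlongrightarrow> (0, 0)) (at (0, 0) within T)"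
    by (rule tendsto_ident_at)
  from tendsto_fst[OF this] tendsto_snd[OF this]
  have lims: "filterlim fst (at 0) (at (0, 0) within T)"
    "filterlim snd (at 0) (at (0, 0) within T)"
    using nonzero by (simp_all add: filterlim_at eventually_conj_iff)
  show "((\<lambda>(dt, dx). scheme_residual F R \<gamma> b \<sigma> U t x dt dx) \<longlongrightarrow>
      vector_derivative (\<lambda>s. U (s, x)) (at t)
      + vector_derivative (\<lambda>y. F (U (t, y))) (at x)
      + \<gamma> *\<^sub>R R (U (t, x)))
     (at (0, 0) within {(dt, dx). 0 < dt \<and> 0 < dx \<and> b * dt / dx \<le> 1/2})"
    unfolding T_def[symmetric] case_prod_beta
    using cont Ut Ux Fx
    by (intro scheme_residual_tendsto lims)
      (auto simp: continuous_on_eq_continuous_at vector_derivative_works)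
qed

theorem theorem5p1:
  fixes \<Omega> :: "(real^'n) set"
    and F R :: "real^'n \<Rightarrow> real^'n"
    and \<gamma> b :: real
  assumes "convex \<Omega>" and "open \<Omega>"
    and "smooth_on \<Omega> F" and "smooth_on \<Omega> R"
    and "hyperbolic_on \<Omega> F"
    and "\<gamma> > 0" and "b > 0"
  shows
    "(\<forall>\<sigma> :: real \<Rightarrow> real^'n^'n.
        continuous_on UNIV \<sigma> \<and> (\<forall>x. invertible (mat 1 + \<sigma> x))
        \<longrightarrow> scheme_consistent \<Omega> F R \<gamma> b \<sigma>)
     \<and>
     (\<forall>(dt::real) (dx::real) (\<sigma> :: int \<Rightarrow> real^'n^'n)
        (U :: int \<Rightarrow> real^'n) (Unew :: int \<Rightarrow> real^'n).
        0 < dt \<and> 0 < dx \<and> b * dt / dx \<le> 1/2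
        \<and> (\<forall>i. invertible (mat 1 + \<sigma> i) \<and> invertible (alpha_den \<gamma> b dx (\<sigma> i)))
        \<and> (\<forall>i. scheme_lhs F \<gamma> b dt dx \<sigma> U Unew i = scheme_rhs F R \<gamma> b dx \<sigma> U i)
        \<and> (\<forall>i. U i \<in> \<Omega>)
        \<and> (\<forall>i. U_star_L F R \<gamma> b dx \<sigma> U i \<in> \<Omega> \<and> U_star_R F R \<gamma> b dx \<sigma> U i \<in> \<Omega>)
        \<longrightarrow> (\<forall>i. Unew i \<in> \<Omega>))"
proof (intro conjI allI impI)
  fix \<sigma> :: "real \<Rightarrow> real^'n^'n"
  assume "continuous_on UNIV \<sigma> \<and> (\<forall>x. invertible (mat 1 + \<sigma> x))"
  then show "scheme_consistent \<Omega> F R \<gamma> b \<sigma>"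
    using assms(3) by (intro scheme_is_consistent) auto
next
  fix dt dx :: real and \<sigma> :: "int \<Rightarrow> real^'n^'n" and U Unew :: "int \<Rightarrow> real^'n" and i
  assume *: "0 < dt \<and> 0 < dx \<and> b * dt / dx \<le> 1/2
        \<and> (\<forall>i. invertible (mat 1 + \<sigma> i) \<and> invertible (alpha_den \<gamma> b dx (\<sigma> i)))
        \<and> (\<forall>i. scheme_lhs F \<gamma> b dt dx \<sigma> U Unew i = scheme_rhs F R \<gamma> b dx \<sigma> U i)
        \<and> (\<forall>i. U i \<in> \<Omega>)
        \<and> (\<forall>i. U_star_L F R \<gamma> b dx \<sigma> U i \<in> \<Omega> \<and> U_star_R F R \<gamma> b dx \<sigma> U i \<in> \<Omega>)"
  then have "Unew i = (1 - 2 * (b * dt / dx)) *\<^sub>R U i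
      + (b * dt / dx) *\<^sub>R U_star_L F R \<gamma> b dx \<sigma> U i
      + (b * dt / dx) *\<^sub>R U_star_R F R \<gamma> b dx \<sigma> U (i-1)"
    using \<open>b > 0\<close> by (intro scheme_update_convex_combination) auto
  also have "\<dots> \<in> \<Omega>"
    using * \<open>b > 0\<close> \<open>convex \<Omega>\<close> by (intro convex_three_points) auto
  finally show "Unew i \<in> \<Omega>" .
qed

end
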